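(* Let $D$ be the Dynkin diagram of the rank 6 hyperbolic Kac-Moody algebra $H^2D_4^{(1)}$ as follows: vertices $1,\dots,6$, single edges $1-2$, $3-4$, $3-5$, $3-6$, and a double edge between $2$ and $3$ with arrow pointing toward $2$ (so $\alpha_1,\alpha_2$ are short and $\alpha_3,\alpha_4,\alpha_5,\alpha_6$ are long). The equivalence classes of nonempty paintings of $D$ are given by (a) $(1)\sim(2)$; (b) $(4)\sim(5)\sim(6)$; (c) $(3)$. That is, the paintings within one item are equivalent, paintings in different items are inequivalent, and every nonempty painting is equivalent to one of those listed.
   Context: A painting of a Dynkin diagram is a choice of a subset of its vertices, called painted (a Vogan diagram with trivial diagram involution). The painting whose painted vertices are exactly $i_1,\dots,i_k$ is denoted $(i_1,\dots,i_k)$. For a painted vertex $i$, the operation $F\langle i\rangle$ (reflection in the noncompact simple root $i$) changes the painting as follows: (i) the color of $i$ and of all vertices not adjacent to $i$ is unchanged; (ii) if $j$ is joined to $i$ by a double edge and $j$ is the long root, the color of $j$ is unchanged; (iii) the colors of all other vertices adjacent to $i$ are reversed. Equivalence $\sim$ of paintings is the equivalence relation generated by all operations $F\langle i\rangle$ ($i$ painted) and by automorphisms of the Dynkin diagram. *)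

theory Defs
  imports Main
begin

text \<open>
  Dynkin diagrams whose edges are single or double. A single edge is an unordered pair of
  vertices; a double edge is an ordered pair \<open>(i, j)\<close> with the arrow pointing from \<open>i\<close> to \<open>j\<close>,
  i.e. \<open>i\<close> is the long and \<open>j\<close> the short root.
\<close>

record 'v dynkin_diagram =
  verts :: "'v set"
  single_edges :: "'v set set"
  double_edges :: "('v \<times> 'v) set"

definition wf_dynkin :: "'v dynkin_diagram \<Rightarrow> bool" where
  "wf_dynkin D \<longleftrightarrow>
     finite (verts D) \<and>
     (\<forall>e \<in> single_edges D. e \<subseteq> verts D \<and> card e = 2) \<and>
     (\<forall>(i, j) \<in> double_edges D. i \<in> verts D \<and> j \<in> verts D \<and> i \<noteq> j \<and>
        (j, i) \<notin> double_edges D \<and> {i, j} \<notin> single_edges D)"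

definition double_edge :: "'v dynkin_diagram \<Rightarrow> 'v \<Rightarrow> 'v \<Rightarrow> bool" where
  "double_edge D i j \<longleftrightarrow> (i, j) \<in> double_edges D \<or> (j, i) \<in> double_edges D"

definition adjacent :: "'v dynkin_diagram \<Rightarrow> 'v \<Rightarrow> 'v \<Rightarrow> bool" where
  "adjacent D i j \<longleftrightarrow> {i, j} \<in> single_edges D \<or> double_edge D i j"

text \<open>A painting is given by its set of painted vertices.\<close>

definition painting :: "'v dynkin_diagram \<Rightarrow> 'v set \<Rightarrow> bool" where
  "painting D P \<longleftrightarrow> P \<subseteq> verts D"

text \<open>
  The operation \<open>F\<langle>i\<rangle>\<close>. The colour of \<open>j\<close> is reversed iff \<open>j\<close> is adjacent to \<open>i\<close>, unless \<open>j\<close> is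
  the long root of a double edge joining \<open>i\<close> and \<open>j\<close>, which is the condition
  \<open>(j, i) \<in> double_edges D\<close>.
\<close>

definition F_op :: "'v dynkin_diagram \<Rightarrow> 'v \<Rightarrow> 'v set \<Rightarrow> 'v set" where
  "F_op D i P =
     {j \<in> verts D. if adjacent D i j \<and> (j, i) \<notin> double_edges D then j \<notin> P else j \<in> P}"

definition dynkin_automorphism :: "'v dynkin_diagram \<Rightarrow> ('v \<Rightarrow> 'v) \<Rightarrow> bool" where
  "dynkin_automorphism D \<sigma> \<longleftrightarrow>
     bij_betw \<sigma> (verts D) (verts D) \<and>
     (\<forall>i \<in> verts D. \<forall>j \<in> verts D.
        ({\<sigma> i, \<sigma> j} \<in> single_edges D \<longleftrightarrow> {i, j} \<in> single_edges D) \<and>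
        ((\<sigma> i, \<sigma> j) \<in> double_edges D \<longleftrightarrow> (i, j) \<in> double_edges D))"

inductive painting_move :: "'v dynkin_diagram \<Rightarrow> 'v set \<Rightarrow> 'v set \<Rightarrow> bool" for D where
  F: "painting D P \<Longrightarrow> i \<in> P \<Longrightarrow> painting_move D P (F_op D i P)"
| aut: "painting D P \<Longrightarrow> dynkin_automorphism D \<sigma> \<Longrightarrow> painting_move D P (\<sigma> ` P)"

definition painting_equiv :: "'v dynkin_diagram \<Rightarrow> 'v set \<Rightarrow> 'v set \<Rightarrow> bool" where
  "painting_equiv D = equivclp (painting_move D)"

definition H2D41 :: "nat dynkin_diagram" where
  "H2D41 =
     \<lparr>verts = {1..6},
      single_edges = {{1, 2}, {3, 4}, {3, 5}, {3, 6}},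
      double_edges = {(3, 2)}\<rparr>"

lemma wf_dynkin_H2D41: "wf_dynkin H2D41"
  by (auto simp: wf_dynkin_def H2D41_def card_insert_if doubleton_eq_iff)

end

theory Submission
  imports Defs
begin

text \<open>
  The colours of the vertices 3, 4, 5, 6 evolve independently of those of 1 and 2, since 3 is long
  in the double edge. Within this \<open>D\<^sub>4\<close>, operations preserve whether some vertex is painted and
  whether 4, 5, 6 all have the same colour, because \<open>F\<langle>3\<rangle>\<close> reverses all three of them; these two
  properties separate the classes. Conversely, any painting with a painted vertex in \<open>D\<^sub>4\<close> can be
  moved to one where 3 is painted. Then \<open>F\<langle>1\<rangle>\<close>, \<open>F\<langle>2\<rangle>\<close>, \<open>F\<langle>3\<rangle>\<close> can be used to remove the
  colours of 1 and 2 and to complement the set of painted leaves of \<open>D\<^sub>4\<close>.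
\<close>

section \<open>The diagram and its operations in explicit form\<close>

lemma verts_H2D41: "verts H2D41 = {1, 2, 3, 4, 5, 6}"
  by (auto simp: H2D41_def)

lemma painting_H2D41: "painting H2D41 P \<longleftrightarrow> P \<subseteq> {1, 2, 3, 4, 5, 6}"
  by (simp add: painting_def verts_H2D41)

lemma single_edges_H2D41:
  "{i, j} \<in> single_edges H2D41 \<longleftrightarrow>
    i = 1 \<and> j = 2 \<or> i = 2 \<and> j = 1 \<or> i = 3 \<and> j \<in> {4, 5, 6} \<or> j = 3 \<and> i \<in> {4, 5, 6}"
  unfolding H2D41_def by (auto simp: doubleton_eq_iff)

lemma double_edges_H2D41: "(i, j) \<in> double_edges H2D41 \<longleftrightarrow> i = 3 \<and> j = 2"
  by (simp add: H2D41_def)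

text \<open>Which colours get reversed depends on \<open>i\<close> alone, so the operation is the
  symmetric difference with a fixed set \<open>N\<close>.\<close>

lemma F_op_sym_diff:
  assumes "P \<subseteq> verts D" "N \<subseteq> verts D"
    and "\<And>j. adjacent D i j \<and> (j, i) \<notin> double_edges D \<longleftrightarrow> j \<in> N"
  shows "F_op D i P = P - N \<union> (N - P)"
  unfolding F_op_def assms(3) using assms(1,2) by auto

text \<open>The double edge acts one way only: \<open>F_op\<close> at 3 reverses the short vertex 2,
  while \<open>F_op\<close> at 2 leaves the long vertex 3 alone.\<close>

lemma F_op_H2D41:
  assumes P: "P \<subseteq> {1, 2, 3, 4, 5, 6}"
  shows "F_op H2D41 1 P = P - {2} \<union> ({2} - P)"
    and "F_op H2D41 2 P = P - {1} \<union> ({1} - P)"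
    and "F_op H2D41 3 P = P - {2, 4, 5, 6} \<union> ({2, 4, 5, 6} - P)"
    and "i \<in> {4, 5, 6} \<Longrightarrow> F_op H2D41 i P = P - {3} \<union> ({3} - P)"
proof -
  have P': "P \<subseteq> verts H2D41"
    using P by (simp only: verts_H2D41)
  note adj = adjacent_def double_edge_def single_edges_H2D41 double_edges_H2D41
  show "F_op H2D41 1 P = P - {2} \<union> ({2} - P)"
    by (rule F_op_sym_diff[OF P']) (auto simp: verts_H2D41 adj)
  show "F_op H2D41 2 P = P - {1} \<union> ({1} - P)"
    by (rule F_op_sym_diff[OF P']) (auto simp: verts_H2D41 adj)
  show "F_op H2D41 3 P = P - {2, 4, 5, 6} \<union> ({2, 4, 5, 6} - P)"
    by (rule F_op_sym_diff[OF P']) (auto simp: verts_H2D41 adj)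
  show "F_op H2D41 i P = P - {3} \<union> ({3} - P)" if "i \<in> {4, 5, 6}"
    by (rule F_op_sym_diff[OF P']) (use that in \<open>auto simp: verts_H2D41 adj\<close>)
qed

lemma painting_equiv_refl: "painting_equiv D P P"
  by (simp add: painting_equiv_def)

lemma painting_equiv_sym: "painting_equiv D P Q \<Longrightarrow> painting_equiv D Q P"
  unfolding painting_equiv_def by (rule equivclp_sym)

lemma painting_equiv_trans [trans]:
  "painting_equiv D P Q \<Longrightarrow> painting_equiv D Q R \<Longrightarrow> painting_equiv D P R"
  unfolding painting_equiv_def by (rule equivclp_trans)

lemma painting_equiv_move: "painting_move D P Q \<Longrightarrow> painting_equiv D P Q"
  unfolding painting_equiv_def by (rule r_into_equivclp)

lemma painting_equiv_F:
  "painting D P \<Longrightarrow> i \<in> P \<Longrightarrow> F_op D i P = Q \<Longrightarrow> painting_equiv D P Q"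
  using painting_equiv_move painting_move.F by metis

section \<open>Automorphisms of the diagram\<close>

lemma dynkin_automorphism_transpose_leaves:
  assumes "i \<in> {4, 5, 6}" "j \<in> {4, 5, 6}"
  shows "dynkin_automorphism H2D41 (id(i := j, j := i))" (is "dynkin_automorphism _ ?\<sigma>")
proof -
  have "bij_betw ?\<sigma> {1, 2, 3, 4, 5, 6} {1, 2, 3, 4, 5, 6}"
    by (rule bij_betw_byWitness[where f' = ?\<sigma>]) (use assms in auto)
  \<comment> \<open>The edge descriptions mention vertices only through membership in
    \<open>{4, 5, 6}\<close> and equations with 1, 2 or 3, so invariance of these conditions
    suffices.\<close>
  moreover have "?\<sigma> k \<in> {4, 5, 6} \<longleftrightarrow> k \<in> {4, 5, 6}" for k
    using assms by (simp only: fun_upd_apply id_apply split: if_split) blast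
  moreover have "?\<sigma> k = l \<longleftrightarrow> k = l" if "l \<in> {1, 2, 3}" for k l
  proof -
    have "l \<noteq> i" "l \<noteq> j"
      using that assms by auto
    then show ?thesis by auto
  qed
  ultimately show ?thesis
    unfolding dynkin_automorphism_def verts_H2D41 single_edges_H2D41 double_edges_H2D41
    by (simp only: insert_iff simp_thms ball_triv)
qed

lemma painting_equiv_leaves:
  assumes "i \<in> {4, 5, 6}" "j \<in> {4, 5, 6}"
  shows "painting_equiv H2D41 {i} {j}"
proof -
  have "painting_move H2D41 {i} ((id(i := j, j := i)) ` {i})"
    using assms by (intro painting_move.aut dynkin_automorphism_transpose_leaves)
      (auto simp: painting_H2D41)
  moreover have "(id(i := j, j := i)) ` {i} = {j}"
    by auto
  ultimately show ?thesis
    using painting_equiv_move by metis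
qed

text \<open>The only double edge must go to itself, which fixes 3; the leaves are then permuted,
  being exactly the vertices joined to 3 by a single edge.\<close>

lemma dynkin_automorphism_H2D41:
  assumes "dynkin_automorphism H2D41 \<sigma>"
  shows "inj_on \<sigma> {1, 2, 3, 4, 5, 6}" "\<sigma> 3 = 3" "\<sigma> ` {4, 5, 6} = {4, 5, 6}"
proof -
  have bij: "bij_betw \<sigma> {1, 2, 3, 4, 5, 6} {1, 2, 3, 4, 5, 6}"
    and single: "i \<in> {1, 2, 3, 4, 5, 6} \<Longrightarrow> j \<in> {1, 2, 3, 4, 5, 6} \<Longrightarrow>
      {\<sigma> i, \<sigma> j} \<in> single_edges H2D41 \<longleftrightarrow> {i, j} \<in> single_edges H2D41"
    and double: "i \<in> {1, 2, 3, 4, 5, 6} \<Longrightarrow> j \<in> {1, 2, 3, 4, 5, 6} \<Longrightarrow>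
      (\<sigma> i, \<sigma> j) \<in> double_edges H2D41 \<longleftrightarrow> (i, j) \<in> double_edges H2D41" for i j
    using assms unfolding dynkin_automorphism_def verts_H2D41 by blast+
  show inj: "inj_on \<sigma> {1, 2, 3, 4, 5, 6}"
    using bij by (rule bij_betw_imp_inj_on)
  show three: "\<sigma> 3 = 3"
    using double[of 3 2] by (simp add: H2D41_def)
  have "\<sigma> i \<in> {4, 5, 6}" if "i \<in> {4, 5, 6}" for i
    using single[of 3 i] that three by (auto simp: H2D41_def doubleton_eq_iff)
  then have "\<sigma> ` {4, 5, 6} \<subseteq> {4, 5, 6}"
    by (rule image_subsetI)
  moreover have "inj_on \<sigma> {4, 5, 6}"
    by (rule inj_on_subset[OF inj]) simp
  ultimately show "\<sigma> ` {4, 5, 6} = {4, 5, 6}"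
    by (intro card_subset_eq) (simp_all only: card_image finite.intros)
qed

section \<open>The invariant that separates the classes\<close>

definition D4_invariant :: "nat set \<Rightarrow> bool \<times> bool" where
  "D4_invariant P = (P \<inter> {3, 4, 5, 6} = {}, P \<inter> {4, 5, 6} \<in> {{}, {4, 5, 6}})"

text \<open>The membership form suits the explicit operations; the intersections in the definition
  suit images under automorphisms.\<close>

lemma D4_invariant_mem:
  "D4_invariant P = (3 \<notin> P \<and> 4 \<notin> P \<and> 5 \<notin> P \<and> 6 \<notin> P,
    (4 \<in> P \<longleftrightarrow> 5 \<in> P) \<and> (5 \<in> P \<longleftrightarrow> 6 \<in> P))"
proof -
  have "P \<inter> {4, 5, 6} = {4, 5, 6} \<longleftrightarrow> 4 \<in> P \<and> 5 \<in> P \<and> 6 \<in> P"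
    by blast
  moreover have "P \<inter> {4, 5, 6} = {} \<longleftrightarrow> 4 \<notin> P \<and> 5 \<notin> P \<and> 6 \<notin> P"
    by blast
  moreover have "P \<inter> {3, 4, 5, 6} = {} \<longleftrightarrow> 3 \<notin> P \<and> 4 \<notin> P \<and> 5 \<notin> P \<and> 6 \<notin> P"
    by blast
  ultimately show ?thesis
    unfolding D4_invariant_def insert_iff empty_iff prod.inject by argo
qed

text \<open>At 1 or 2 nothing in the \<open>D4\<close> part changes. At 3 the leaves are
  complemented while 3 stays painted. At a leaf only 3 changes, while that leaf stays
  painted.\<close>

lemma D4_invariant_F_op:
  assumes "P \<subseteq> {1, 2, 3, 4, 5, 6}" "i \<in> P"
  shows "D4_invariant (F_op H2D41 i P) = D4_invariant P"
proof -
  consider "i = 1" | "i = 2" | "i = 3" | "i \<in> {4, 5, 6}"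
    using assms by blast
  then show ?thesis
  proof cases
    case 4
    then show ?thesis
      using assms(2) by (auto simp only: F_op_H2D41(4)[OF assms(1)] D4_invariant_mem)
  qed (use assms(2) in \<open>simp_all add: F_op_H2D41[OF assms(1)] D4_invariant_mem del: One_nat_def\<close>)
qed

text \<open>Both vertex sets in the invariant are mapped onto themselves, and by injectivity taking
  images commutes with intersecting.\<close>

lemma D4_invariant_automorphism:
  assumes P: "P \<subseteq> {1, 2, 3, 4, 5, 6}" and \<sigma>: "dynkin_automorphism H2D41 \<sigma>"
  shows "D4_invariant (\<sigma> ` P) = D4_invariant P"
proof -
  note inj = dynkin_automorphism_H2D41(1)[OF \<sigma>]
  have leaves: "\<sigma> ` {4, 5, 6} = {4, 5, 6}"
    by (rule dynkin_automorphism_H2D41(3)[OF \<sigma>])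
  have D4: "\<sigma> ` {3, 4, 5, 6} = {3, 4, 5, 6}"
    using leaves dynkin_automorphism_H2D41(2)[OF \<sigma>] by (metis image_insert)
  have "\<sigma> ` P \<inter> {4, 5, 6} = \<sigma> ` (P \<inter> {4, 5, 6})"
    using inj_on_image_Int[OF inj P, of "{4, 5, 6}"] leaves by auto
  moreover have "\<sigma> ` P \<inter> {3, 4, 5, 6} = \<sigma> ` (P \<inter> {3, 4, 5, 6})"
    using inj_on_image_Int[OF inj P, of "{3, 4, 5, 6}"] D4 by auto
  moreover have "\<sigma> ` (P \<inter> {4, 5, 6}) = {4, 5, 6} \<longleftrightarrow> P \<inter> {4, 5, 6} = {4, 5, 6}"
    using inj_on_image_eq_iff[OF inj le_infI1[OF P], of "{4, 5, 6}" "{4, 5, 6}"]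
    unfolding leaves by simp
  ultimately show ?thesis
    by (simp add: D4_invariant_def)
qed

lemma D4_invariant_equiv:
  assumes "painting_equiv H2D41 P Q"
  shows "D4_invariant P = D4_invariant Q"
proof -
  have move: "D4_invariant P = D4_invariant Q" if "painting_move H2D41 P Q" for P Q
    using that
    by cases (simp_all add: painting_H2D41 D4_invariant_F_op D4_invariant_automorphism)
  from assms show ?thesis
    unfolding painting_equiv_def
    by (induction rule: equivclp_induct) (auto dest: move)
qed

section \<open>Changing the colours around vertex 3\<close>

lemma painting_equiv_two:
  assumes A: "A \<subseteq> {1, 2}" "A \<noteq> {}" and Y: "Y \<subseteq> {3, 4, 5, 6}"
  shows "painting_equiv H2D41 (A \<union> Y) ({2} \<union> Y)"
proof -
  have sub: "B \<union> Y \<subseteq> {1, 2, 3, 4, 5, 6}" if "B \<subseteq> {1, 2}" for B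
    using that Y by (intro Un_least) (erule order_trans, simp)+
  have notin: "1 \<notin> Y" "2 \<notin> Y"
    using Y by (auto dest: subsetD)
  have "F_op H2D41 1 ({1} \<union> Y) = {1, 2} \<union> Y"
    unfolding F_op_H2D41(1)[OF sub[of "{1}", OF insert_mono[OF empty_subsetI]]]
    using notin by (auto simp del: One_nat_def)
  then have 1: "painting_equiv H2D41 ({1} \<union> Y) ({1, 2} \<union> Y)"
    using sub[of "{1}"] by (intro painting_equiv_F[where i = 1]) (simp_all add: painting_H2D41)
  have "F_op H2D41 2 ({2} \<union> Y) = {1, 2} \<union> Y"
    unfolding F_op_H2D41(2)[OF sub[of "{2}", OF subset_insertI]]
    using notin by (auto simp del: One_nat_def)
  then have 2: "painting_equiv H2D41 ({2} \<union> Y) ({1, 2} \<union> Y)"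
    using sub[of "{2}"] by (intro painting_equiv_F[where i = 2]) (simp_all add: painting_H2D41)
  \<comment> \<open>Both \<open>{1}\<close> and \<open>{2}\<close> reach \<open>{1, 2}\<close> in
    one move, so the three nonempty choices of \<open>A\<close> are equivalent over the same
    \<open>Y\<close>.\<close>
  have "A = {1} \<or> A = {2} \<or> A = {1, 2}"
    using A by blast
  then show ?thesis
    using 1 2 painting_equiv_refl painting_equiv_sym painting_equiv_trans by metis
qed

lemma painting_equiv_three:
  assumes A: "A \<subseteq> {1, 2}" and X: "X \<subseteq> {4, 5, 6}"
  shows "painting_equiv H2D41 (A \<union> {3} \<union> X)
    (A - {2} \<union> ({2} - A) \<union> {3} \<union> ({4, 5, 6} - X))"
proof -
  have sub: "A \<union> {3} \<union> X \<subseteq> {1, 2, 3, 4, 5, 6}"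
  proof (intro Un_least)
    show "A \<subseteq> {1, 2, 3, 4, 5, 6}" using A by (rule order_trans) simp
    show "X \<subseteq> {1, 2, 3, 4, 5, 6}" using X by (rule order_trans) simp
  qed simp
  have notin: "4 \<notin> A" "5 \<notin> A" "6 \<notin> A" "2 \<notin> X"
    using A X by (auto dest: subsetD)
  have "A \<union> {3} \<union> X - {2, 4, 5, 6} = A - {2} \<union> {3}"
    using notin X by auto
  moreover have "{2, 4, 5, 6} - (A \<union> {3} \<union> X) = {2} - A \<union> ({4, 5, 6} - X)"
    using notin by auto
  ultimately have "F_op H2D41 3 (A \<union> {3} \<union> X)
      = A - {2} \<union> ({2} - A) \<union> {3} \<union> ({4, 5, 6} - X)"
    unfolding F_op_H2D41(3)[OF sub] by (simp only: Un_ac)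
  then show ?thesis
    using sub by (intro painting_equiv_F[where i = 3]) (simp_all add: painting_H2D41)
qed

text \<open>Read forwards, this brings 3 into the painting; read backwards, it removes 3 next to a
  single painted leaf.\<close>

lemma painting_equiv_leaf:
  assumes P: "P \<subseteq> {1, 2, 3, 4, 5, 6}" and i: "i \<in> P" "i \<in> {4, 5, 6}" and "3 \<notin> P"
  shows "painting_equiv H2D41 P (insert 3 P)"
proof -
  have "F_op H2D41 i P = insert 3 P"
    unfolding F_op_H2D41(4)[OF P i(2)] using \<open>3 \<notin> P\<close> by auto
  then show ?thesis
    using P i(1) by (intro painting_equiv_F) (simp_all add: painting_H2D41)
qed

text \<open>\<open>F_op\<close> at 3 is used three times, which complements the leaves once in
  total. Moves on 1 and 2 in between arrange that its reversals of 2 leave both unpainted at the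
  end: the short part runs through \<open>{}\<close>, \<open>{2}\<close>, \<open>{1, 2}\<close>,
  \<open>{1}\<close>, \<open>{2}\<close>, \<open>{}\<close>.\<close>

lemma painting_equiv_complement_leaves:
  assumes X: "X \<subseteq> {4, 5, 6}"
  shows "painting_equiv H2D41 ({3} \<union> X) ({3} \<union> ({4, 5, 6} - X))"
proof -
  define Y where "Y = {4, 5, 6} - X"
  have Y: "Y \<subseteq> {4, 5, 6}" and X_eq: "{4, 5, 6} - Y = X"
    using X by (auto simp: Y_def)
  have "painting_equiv H2D41 ({3} \<union> X) ({2} \<union> ({3} \<union> Y))"
    using painting_equiv_three[of "{}" X] X by (simp add: Y_def)
  also have "painting_equiv H2D41 ({2} \<union> ({3} \<union> Y)) ({1, 2} \<union> ({3} \<union> Y))"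
    by (rule painting_equiv_sym, rule painting_equiv_two) (use Y in auto)
  also have "painting_equiv H2D41 ({1, 2} \<union> ({3} \<union> Y)) ({1} \<union> ({3} \<union> X))"
    using painting_equiv_three[of "{1, 2}" Y] Y X_eq by (simp add: insert_Diff_if)
  also have "painting_equiv H2D41 ({1} \<union> ({3} \<union> X)) ({2} \<union> ({3} \<union> X))"
    by (rule painting_equiv_two) (use X in auto)
  also have "painting_equiv H2D41 ({2} \<union> ({3} \<union> X)) ({3} \<union> Y)"
    using painting_equiv_three[of "{2}" X] X by (simp add: Y_def)
  finally show ?thesis
    by (simp add: Y_def)
qed

text \<open>A nonempty \<open>A\<close> is first turned into \<open>{2}\<close>; \<open>F_op\<close>
  at 3 then erases 2, and its side effect on the leaves is undone by complementing them
  again.\<close>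

lemma painting_equiv_clear_short:
  assumes A: "A \<subseteq> {1, 2}" and X: "X \<subseteq> {4, 5, 6}"
  shows "painting_equiv H2D41 (A \<union> ({3} \<union> X)) ({3} \<union> X)"
proof (cases "A = {}")
  case True
  then show ?thesis by (simp add: painting_equiv_refl)
next
  case False
  have "painting_equiv H2D41 (A \<union> ({3} \<union> X)) ({2} \<union> ({3} \<union> X))"
    by (rule painting_equiv_two) (use A X False in auto)
  also have "painting_equiv H2D41 ({2} \<union> ({3} \<union> X)) ({3} \<union> ({4, 5, 6} - X))"
    using painting_equiv_three[of "{2}" X] X by simp
  also have "painting_equiv H2D41 ({3} \<union> ({4, 5, 6} - X)) ({3} \<union> X)"
    by (rule painting_equiv_sym, rule painting_equiv_complement_leaves[OF X])
  finally show ?thesis .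
qed

section \<open>Reduction to a single painted vertex\<close>

lemma painting_equiv_representative_three:
  assumes P: "P \<subseteq> {1, 2, 3, 4, 5, 6}" and "3 \<in> P"
  shows "\<exists>i \<in> {3, 4, 5, 6}. painting_equiv H2D41 P {i}"
proof -
  define X where "X = P \<inter> {4, 5, 6}"
  have X: "X \<subseteq> {4, 5, 6}"
    by (simp add: X_def)
  have "P = P \<inter> {1, 2} \<union> ({3} \<union> X)"
    using assms by (auto simp: X_def)
  then have PX: "painting_equiv H2D41 P ({3} \<union> X)"
    using painting_equiv_clear_short[of "P \<inter> {1, 2}" X] X by simp
  then have PY: "painting_equiv H2D41 P ({3} \<union> ({4, 5, 6} - X))"
    by (rule painting_equiv_trans[OF _ painting_equiv_complement_leaves[OF X]])
  \<comment> \<open>\<open>X\<close> matters only up to complement, and of two complementary sets of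
    three leaves one has at most one element.\<close>
  consider "X = {}" | "{4, 5, 6} - X = {}"
    | i where "i \<in> {4, 5, 6}" "X = {i} \<or> {4, 5, 6} - X = {i}"
  proof -
    have "X \<in> Pow {4, 5, 6}"
      using X by (rule PowI)
    then have "X \<in> {{}, {4}, {5}, {6}, {4, 5}, {4, 6}, {5, 6}, {4, 5, 6}}"
      by (simp add: Pow_insert) argo
    then show ?thesis
      using that(1,2) that(3)[of 4] that(3)[of 5] that(3)[of 6]
      by (elim insertE emptyE) (simp_all add: insert_Diff_if)
  qed
  then show ?thesis
  proof cases
    case 1
    then show ?thesis using PX by auto
  next
    case 2
    then show ?thesis using PY by auto
  next
    case (3 i)
    \<comment> \<open>A move at the leaf \<open>i\<close> paints 3 in \<open>{i}\<close>; its
      reverse discards 3.\<close>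
    have "painting_equiv H2D41 ({3} \<union> {i}) {i}"
      using painting_equiv_leaf[of "{i}" i] 3(1) by (auto intro: painting_equiv_sym simp: insert_commute)
    then have "painting_equiv H2D41 P {i}"
      using PX PY 3(2) painting_equiv_trans by metis
    then show ?thesis using 3(1) by blast
  qed
qed

lemma painting_equiv_representative:
  assumes P: "P \<subseteq> {1, 2, 3, 4, 5, 6}" and "P \<noteq> {}"
  shows "\<exists>i \<in> {1, 2, 3, 4, 5, 6}. painting_equiv H2D41 P {i}"
proof -
  \<comment> \<open>A painted leaf lets 3 be painted, reducing to the first case; otherwise only
    short vertices are painted and \<open>{2}\<close> represents the class.\<close>
  consider "3 \<in> P" | i where "3 \<notin> P" "i \<in> {4, 5, 6}" "i \<in> P" | "P \<subseteq> {1, 2}"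
    using P by blast
  then show ?thesis
  proof cases
    case 1
    then show ?thesis using painting_equiv_representative_three[OF P] by blast
  next
    case (2 i)
    then have "painting_equiv H2D41 P (insert 3 P)"
      using painting_equiv_leaf[OF P] by blast
    moreover obtain j where "j \<in> {3, 4, 5, 6}" "painting_equiv H2D41 (insert 3 P) {j}"
      using painting_equiv_representative_three[of "insert 3 P"] P by auto
    ultimately show ?thesis
      using painting_equiv_trans by blast
  next
    case 3
    then show ?thesis
      using painting_equiv_two[of P "{}"] assms(2) by auto
  qed
qed

theorem proposition6p13:
  fixes items :: "nat set set set"
  assumes items: "items = {{{1}, {2}}, {{4}, {5}, {6}}, {{3}}}"
  shows
    "(\<forall>I \<in> items. \<forall>P \<in> I. \<forall>Q \<in> I. painting_equiv H2D41 P Q) \<and>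
     (\<forall>I \<in> items. \<forall>J \<in> items. I \<noteq> J \<longrightarrow>
        (\<forall>P \<in> I. \<forall>Q \<in> J. \<not> painting_equiv H2D41 P Q)) \<and>
     (\<forall>P. painting H2D41 P \<and> P \<noteq> {} \<longrightarrow>
        (\<exists>I \<in> items. \<exists>Q \<in> I. painting_equiv H2D41 P Q))"
proof (intro conjI)
  have "painting_equiv H2D41 {1} {2}"
    using painting_equiv_two[of "{1}" "{}"] by simp
  then show "\<forall>I \<in> items. \<forall>P \<in> I. \<forall>Q \<in> I. painting_equiv H2D41 P Q"
    by (simp add: items painting_equiv_refl painting_equiv_sym painting_equiv_leaves)
next
  \<comment> \<open>\<open>D4_invariant\<close> is \<open>(True, True)\<close> on \<open>{1}\<close>
    and \<open>{2}\<close>, \<open>(False, False)\<close> on the leaves, and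
    \<open>(False, True)\<close> on \<open>{3}\<close>.\<close>
  show "\<forall>I \<in> items. \<forall>J \<in> items. I \<noteq> J \<longrightarrow>
      (\<forall>P \<in> I. \<forall>Q \<in> J. \<not> painting_equiv H2D41 P Q)"
    unfolding items by (auto dest!: D4_invariant_equiv simp: D4_invariant_mem)
next
  show "\<forall>P. painting H2D41 P \<and> P \<noteq> {} \<longrightarrow>
      (\<exists>I \<in> items. \<exists>Q \<in> I. painting_equiv H2D41 P Q)"
  proof (intro allI impI)
    fix P
    assume "painting H2D41 P \<and> P \<noteq> {}"
    then obtain i where "i \<in> {1, 2, 3, 4, 5, 6}" "painting_equiv H2D41 P {i}"
      using painting_equiv_representative unfolding painting_H2D41 by metis
    moreover from this(1) have "\<exists>I \<in> items. {i} \<in> I"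
      unfolding items by auto
    ultimately show "\<exists>I \<in> items. \<exists>Q \<in> I. painting_equiv H2D41 P Q"
      by blast
  qed
qed

end
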